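(* Assume that a Hamel basis of $\mathbb{R}$ over $\mathbb{Q}$ exists. There exists a bilaterally $\mathbb{Q}$-continuous function $f:\mathbb{R}\to\mathbb{R}$ that is not continuous at $0$ with respect to $\tau_{\mathcal{H}}$ (i.e. as a map from $(\mathbb{R},\tau_{\mathcal{H}})$ to $\mathbb{R}$ with the usual topology). In particular, neither bilateral $\mathbb{Q}$-continuity nor $\mathbb{Q}$-continuity implies $\tau_{\mathcal{H}}$-continuity.
   Context: The existence of a Hamel basis (a basis of $\mathbb{R}$ as a $\mathbb{Q}$-vector space) is assumed in addition to ZF. A function $H:\mathbb{R}\to\mathbb{R}$ is additive if $H(x+y)=H(x)+H(y)$ for all $x,y$. $\tau_{\mathcal{H}}$ is the initial topology on $\mathbb{R}$ generated by all additive functions, i.e. the smallest topology making every additive $H$ continuous as a map from $(\mathbb{R},\tau_{\mathcal{H}})$ to $\mathbb{R}$ with the usual topology. A function is $\tau_{\mathcal{H}}$-continuous if it is continuous from $(\mathbb{R},\tau_{\mathcal{H}})$ to $\mathbb{R}$ with the usual topology. For real $y\neq z$ put $S(y,z)=\{qy+(1-q)z: q\in\mathbb{Q}\cap[0,1]\}$. $f$ is bilaterally $\mathbb{Q}$-continuous if for every $x\in\mathbb{R}$ there is $\epsilon>0$ such that for all $y,z$ with $x-\epsilon\le y<z\le x+\epsilon$ there is a continuous (in the usual sense) function $f_{y,z}:[y,z]\to\mathbb{R}$ with $f_{y,z}(t)=f(t)$ for all $t\in S(y,z)$. $f$ is $\mathbb{Q}$-continuous if for every $x\in\mathbb{R}$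 there is $\epsilon>0$ such that such an extension $f_{y,z}$ exists for all $y,z$ with $x-\epsilon<y<z\le x$, and there is $\epsilon'>0$ such that it exists for all $y,z$ with $x\le y<z<x+\epsilon'$. *)

theory Defs
  imports "HOL-Analysis.Analysis"
begin

abbreviation rat_scale :: "rat \<Rightarrow> real \<Rightarrow> real" where
  "rat_scale q x \<equiv> of_rat q * x"

lemma vector_space_rat_scale: "vector_space rat_scale"
  by unfold_locales (simp_all add: of_rat_add of_rat_mult algebra_simps)

(* Span and dependence come from the library's module locale, taken at the scalar
   multiplication rat_scale; the real vector space structure of the reals plays no role. *)
definition hamel_basis :: "real set \<Rightarrow> bool" where
  "hamel_basis B \<longleftrightarrow> \<not> module.dependent rat_scale B \<and> module.span rat_scale B = UNIV"

definition tau_H :: "real topology" where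
  "tau_H = topology_generated_by {H -` U | (H :: real \<Rightarrow> real) U. Modules.additive H \<and> open U}"

lemma topspace_tau_H [simp]: "topspace tau_H = UNIV"
proof -
  have "Modules.additive (\<lambda>x::real. x)"
    by unfold_locales simp
  then have "(\<lambda>x::real. x) -` UNIV \<in> {H -` U | (H :: real \<Rightarrow> real) U. Modules.additive H \<and> open U}"
    by blast
  then show ?thesis
    unfolding tau_H_def topology_generated_by_topspace by blast
qed

lemma continuous_map_tau_H_additive:
  fixes H :: "real \<Rightarrow> real"
  assumes "Modules.additive H"
  shows "continuous_map tau_H euclidean H"
proof -
  have "openin tau_H (H -` U)" if "open U" for U
    unfolding tau_H_def by (rule topology_generated_by_Basis) (use assms that in blast)
  then show ?thesis
    by (simp add: continuous_map_alt)
qed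

lemma tau_H_least:
  assumes "topspace T = UNIV"
    and "\<And>H :: real \<Rightarrow> real. Modules.additive H \<Longrightarrow> continuous_map T euclidean H"
    and "openin tau_H W"
  shows "openin T W"
proof -
  have "generate_topology_on {H -` U | (H :: real \<Rightarrow> real) U. Modules.additive H \<and> open U} W"
    using assms(3) unfolding tau_H_def by (rule openin_topology_generated_by)
  then show ?thesis
  proof induct
    case (Basis s)
    then obtain H :: "real \<Rightarrow> real" and U where "Modules.additive H" "open U" "s = H -` U"
      by blast
    then show ?case
      using assms(1) assms(2)[of H] by (simp add: continuous_map_alt)
  qed auto
qed

definition rat_segment :: "real \<Rightarrow> real \<Rightarrow> real set" where
  "rat_segment y z = {q * y + (1 - q) * z | q. q \<in> \<rat> \<inter> {0..1}}"

definition has_cont_extension :: "(real \<Rightarrow> real) \<Rightarrow> real \<Rightarrow> real \<Rightarrow> bool" where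
  "has_cont_extension f y z \<longleftrightarrow>
     (\<exists>g :: real \<Rightarrow> real. continuous_on {y..z} g \<and> (\<forall>t \<in> rat_segment y z. g t = f t))"

definition bilaterally_Q_continuous :: "(real \<Rightarrow> real) \<Rightarrow> bool" where
  "bilaterally_Q_continuous f \<longleftrightarrow>
     (\<forall>x. \<exists>\<epsilon>>0. \<forall>y z. x - \<epsilon> \<le> y \<and> y < z \<and> z \<le> x + \<epsilon> \<longrightarrow> has_cont_extension f y z)"

definition Q_continuous :: "(real \<Rightarrow> real) \<Rightarrow> bool" where
  "Q_continuous f \<longleftrightarrow>
     (\<forall>x. (\<exists>\<epsilon>>0. \<forall>y z. x - \<epsilon> < y \<and> y < z \<and> z \<le> x \<longrightarrow> has_cont_extension f y z) \<and>
          (\<exists>\<epsilon>'>0. \<forall>y z. x \<le> y \<and> y < z \<and> z < x + \<epsilon>' \<longrightarrow> has_cont_extension f y z))"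

end

theory Submission
  imports Defs
begin

text \<open>
  Fix a Hamel basis \<open>B\<close> and let \<open>f x\<close> be the sum of the absolute values of the rational
  coordinates of \<open>x\<close> with respect to \<open>B\<close>, the \<open>l\<^sup>1\<close>-norm of the coordinate vector.

  On a rational segment from \<open>y\<close> to \<open>z\<close> the coordinates are affine functions of the
  rational parameter, and only the finitely many basis elements that occur in \<open>y\<close> or \<open>z\<close>
  contribute. Hence \<open>f\<close> is there a finite sum of absolute values of affine functions, and the same
  formula with a real parameter is the required continuous extension
  (\<open>coord_norm_has_cont_extension\<close>). This works for all \<open>y < z\<close>, so \<open>f\<close> is
  bilaterally \<open>\<rat>\<close>-continuous.

  A neighbourhood of \<open>0\<close> in the initial topology contains a set on which finitely many additive
  functions are smaller than some \<open>e\<close> (\<open>tau_H_nhds_zero\<close>). Such a constraint only asks that a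
  vector in some \<open>\<real>\<^sup>n\<close> be small, whereas \<open>B\<close> is infinite: enough basis elements
  have real linearly dependent images in \<open>\<real>\<^sup>n\<close>, and rational approximations to the
  coefficients of a dependence give a point that satisfies the constraint although one of its
  coordinates is at least \<open>1\<close> in absolute value (\<open>small_additive_large_coordinate\<close>). So
  \<open>f\<close>, which vanishes at \<open>0\<close>, takes values \<open>\<ge> 1\<close> in every neighbourhood of \<open>0\<close>.
\<close>

interpretation Q: vector_space rat_scale
  by (rule vector_space_rat_scale)

section \<open>Additive functions and neighbourhoods of zero\<close>

lemma additive_of_rat_mult:
  fixes H :: "real \<Rightarrow> real"
  assumes "Modules.additive H"
  shows "H (of_rat q * x) = of_rat q * H x"
proof -
  interpret Modules.additive H by fact
  have nat: "H (of_nat n * u) = of_nat n * H u" for n u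
    by (induct n) (simp_all add: zero add distrib_right)
  have int: "H (of_int k * u) = of_int k * H u" for k u
    by (cases k rule: int_cases2) (simp_all add: nat minus)
  obtain a b where q: "q = of_int a / of_int b" and "b > 0"
    by (cases q) (auto simp: Fract_of_int_quotient)
  have "of_int b * H (of_rat q * x) = H (of_int a * x)"
    unfolding int[symmetric] using \<open>b > 0\<close> by (simp add: q of_rat_divide)
  then have "H (of_rat q * x) = of_int a / of_int b * H x"
    unfolding int using \<open>b > 0\<close> by (simp add: field_simps)
  also have "\<dots> = of_rat q * H x"
    by (simp add: q of_rat_divide)
  finally show ?thesis .
qed

text \<open>Additive functions vanish at \<open>0\<close>, so a subbasic set \<open>H -` V\<close> that contains \<open>0\<close> also contains
  the points where \<open>\<bar>H\<bar>\<close> is small. Sets cut out by finitely many such conditions survive finite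
  intersections, after passing to the union of the families and the smaller bound.\<close>

lemma tau_H_nhds_zero:
  assumes "openin tau_H U" "0 \<in> U"
  obtains F :: "(real \<Rightarrow> real) set" and e :: real
  where "finite F" "\<forall>H\<in>F. Modules.additive H" "e > 0" "{x. \<forall>H\<in>F. \<bar>H x\<bar> < e} \<subseteq> U"
proof -
  have "generate_topology_on {H -` V | (H :: real \<Rightarrow> real) V. Modules.additive H \<and> open V} U"
    using assms(1) unfolding tau_H_def by (rule openin_topology_generated_by)
  then have "0 \<in> U \<longrightarrow> (\<exists>(F :: (real \<Rightarrow> real) set) e. finite F \<and> (\<forall>H\<in>F. Modules.additive H) \<and> e > 0 \<and>
      {x. \<forall>H\<in>F. \<bar>H x\<bar> < e} \<subseteq> U)" (is "_ \<longrightarrow> ?nhd U")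
  proof induct
    case Empty
    then show ?case by simp
  next
    case (Int U V)
    show ?case
    proof
      assume "0 \<in> U \<inter> V"
      with Int have "?nhd U" "?nhd V" by simp_all
      obtain F :: "(real \<Rightarrow> real) set" and e where
        F: "finite F" "\<forall>H\<in>F. Modules.additive H" "e > 0" "{x. \<forall>H\<in>F. \<bar>H x\<bar> < e} \<subseteq> U"
        using \<open>?nhd U\<close> by blast
      obtain G :: "(real \<Rightarrow> real) set" and d where
        G: "finite G" "\<forall>H\<in>G. Modules.additive H" "d > 0" "{x. \<forall>H\<in>G. \<bar>H x\<bar> < d} \<subseteq> V"
        using \<open>?nhd V\<close> by blast
      have "{x. \<forall>H\<in>F \<union> G. \<bar>H x\<bar> < min e d} \<subseteq> U \<inter> V"
        using F(4) G(4) by auto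
      moreover have "finite (F \<union> G)" "\<forall>H\<in>F \<union> G. Modules.additive H" "min e d > 0"
        using F G by auto
      ultimately show "?nhd (U \<inter> V)"
        by (intro exI[of _ "F \<union> G"] exI[of _ "min e d"] conjI)
    qed
  next
    case (UN K)
    show ?case
    proof
      assume "0 \<in> \<Union>K"
      then obtain k where "k \<in> K" "0 \<in> k" by blast
      then have "?nhd k" using UN by blast
      then obtain F :: "(real \<Rightarrow> real) set" and e where "finite F" "\<forall>H\<in>F. Modules.additive H" "e > 0"
        "{x. \<forall>H\<in>F. \<bar>H x\<bar> < e} \<subseteq> k"
        by blast
      moreover have "k \<subseteq> \<Union>K" using \<open>k \<in> K\<close> by blast
      ultimately show "?nhd (\<Union>K)" by (meson order_trans)
    qed
  next
    case (Basis s)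
    then obtain H :: "real \<Rightarrow> real" and V where
      H: "Modules.additive H" and V: "open V" and s: "s = H -` V"
      by blast
    show ?case
    proof
      assume "0 \<in> s"
      then have "0 \<in> V"
        using additive.zero[OF H] s by simp
      then obtain e where "e > 0" and e: "ball 0 e \<subseteq> V"
        using V open_contains_ball by blast
      then have "{x. \<forall>H\<in>{H}. \<bar>H x\<bar> < e} \<subseteq> s"
        using s by (auto simp: dist_norm)
      then show "?nhd s"
        using H \<open>e > 0\<close> by (intro exI[of _ "{H}"] exI[of _ e]) simp
    qed
  qed
  then show ?thesis
    using assms(2) that by blast
qed

section \<open>Coordinates with respect to a Hamel basis\<close>

lemma countable_span_finite:
  assumes "finite S"
  shows "countable (Q.span S)"
  using assms
proof induct
  case empty
  then show ?case by simp
next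
  case (insert a S)
  have "Q.span (insert a S) \<subseteq> (\<lambda>(k, u). of_rat k * a + u) ` (UNIV \<times> Q.span S)"
  proof
    fix x assume "x \<in> Q.span (insert a S)"
    then obtain k where "x - of_rat k * a \<in> Q.span S"
      unfolding Q.span_insert by blast
    then show "x \<in> (\<lambda>(k, u). of_rat k * a + u) ` (UNIV \<times> Q.span S)"
      by (intro image_eqI[of _ _ "(k, x - of_rat k * a)"]) auto
  qed
  then show ?case
    using insert by (meson countable_SIGMA countable_image countable_subset countableI_type)
qed

text \<open>A finite basis would make the reals countable.\<close>

lemma infinite_hamel_basis:
  assumes "hamel_basis B"
  shows "infinite B"
proof
  assume "finite B"
  then have "countable (UNIV :: real set)"
    using countable_span_finite assms unfolding hamel_basis_def by metis
  then show False
    using uncountable_UNIV_real by simp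
qed

definition coord :: "real set \<Rightarrow> real \<Rightarrow> real \<Rightarrow> real" where
  "coord B b x = of_rat (Q.representation B x b)"

definition coord_norm :: "real set \<Rightarrow> real \<Rightarrow> real" where
  "coord_norm B x = (\<Sum>b | coord B b x \<noteq> 0. \<bar>coord B b x\<bar>)"

lemma finite_coord_support: "finite {b. coord B b x \<noteq> 0}"
  by (simp add: coord_def Q.finite_representation)

lemma coord_combination:
  assumes "hamel_basis B"
  shows "coord B b (of_rat p * x + of_rat q * y) = of_rat p * coord B b x + of_rat q * coord B b y"
  using assms
  by (simp add: hamel_basis_def coord_def Q.representation_add Q.representation_scale
      of_rat_add of_rat_mult)

lemma coord_basis:
  assumes "hamel_basis B" "b \<in> B"
  shows "coord B c b = (if c = b then 1 else 0)"
  using assms by (simp add: hamel_basis_def coord_def Q.representation_basis)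

lemma coord_norm_superset:
  assumes "finite A" "{b. coord B b x \<noteq> 0} \<subseteq> A"
  shows "coord_norm B x = (\<Sum>b\<in>A. \<bar>coord B b x\<bar>)"
  unfolding coord_norm_def using assms by (intro sum.mono_neutral_left) auto

lemma coord_norm_zero: "coord_norm B 0 = 0"
  by (simp add: coord_norm_def coord_def Q.representation_zero)

lemma abs_coord_le_coord_norm: "\<bar>coord B b x\<bar> \<le> coord_norm B x"
proof (cases "coord B b x = 0")
  case True
  then show ?thesis by (simp add: coord_norm_def sum_nonneg)
next
  case False
  then show ?thesis
    unfolding coord_norm_def using finite_coord_support[of B x]
    by (intro member_le_sum[of b _ "\<lambda>b. \<bar>coord B b x\<bar>"]) auto
qed

section \<open>Continuity along rational segments\<close>

text \<open>The basis elements occurring in \<open>y\<close> or \<open>z\<close> form one finite index set for all points of the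
  rational segment, although the supports of these points vary. Over this index set the coordinate
  norm is given by a single formula, and the formula makes sense at every real point.\<close>

lemma coord_norm_has_cont_extension:
  assumes B: "hamel_basis B" and "y < z"
  shows "has_cont_extension (coord_norm B) y z"
proof -
  define A where "A = {b. coord B b y \<noteq> 0} \<union> {b. coord B b z \<noteq> 0}"
  \<comment> \<open>The weights \<open>(z - t) / (z - y)\<close> and \<open>(t - y) / (z - y)\<close> are the parameters \<open>q\<close> and \<open>1 - q\<close>
    recovered from \<open>t = q * y + (1 - q) * z\<close>.\<close>
  define g where "g t = (\<Sum>b\<in>A. \<bar>(z - t) / (z - y) * coord B b y + (t - y) / (z - y) * coord B b z\<bar>)"
    for t
  have "continuous_on {y..z} g"
    unfolding g_def by (intro continuous_intros) (use \<open>y < z\<close> in auto)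
  moreover have "g t = coord_norm B t" if seg: "t \<in> rat_segment y z" for t
  proof -
    obtain q where "q \<in> \<rat>" and q: "t = q * y + (1 - q) * z"
      using seg unfolding rat_segment_def by blast
    obtain r where "q = of_rat r"
      using \<open>q \<in> \<rat>\<close> by (rule Rats_cases)
    then have t: "t = of_rat r * y + (1 - of_rat r) * z"
      using q by simp
    have coord: "coord B b t = of_rat r * coord B b y + (1 - of_rat r) * coord B b z" for b
      using coord_combination[OF B, of b r y "1 - r" z] by (simp add: t of_rat_diff)
    have "z - t = of_rat r * (z - y)" "t - y = (1 - of_rat r) * (z - y)"
      by (simp_all add: t algebra_simps)
    then have "(z - t) / (z - y) = of_rat r" "(t - y) / (z - y) = 1 - of_rat r"
      using \<open>y < z\<close> by simp_all
    then have "g t = (\<Sum>b\<in>A. \<bar>coord B b t\<bar>)"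
      by (simp add: g_def coord)
    also have "\<dots> = coord_norm B t"
      by (rule coord_norm_superset[symmetric]) (auto simp: A_def finite_coord_support coord)
    finally show ?thesis .
  qed
  ultimately show ?thesis
    unfolding has_cont_extension_def by blast
qed

lemma bilaterally_Q_continuous_coord_norm:
  assumes "hamel_basis B"
  shows "bilaterally_Q_continuous (coord_norm B)"
  unfolding bilaterally_Q_continuous_def
  using coord_norm_has_cont_extension[OF assms] zero_less_one by blast

lemma bilaterally_Q_continuous_imp_Q_continuous:
  assumes "bilaterally_Q_continuous f"
  shows "Q_continuous f"
  unfolding Q_continuous_def
proof
  fix x
  obtain e where e: "e > 0"
    "\<And>y z. x - e \<le> y \<and> y < z \<and> z \<le> x + e \<Longrightarrow> has_cont_extension f y z"
    using assms unfolding bilaterally_Q_continuous_def by blast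
  then show "(\<exists>\<epsilon>>0. \<forall>y z. x - \<epsilon> < y \<and> y < z \<and> z \<le> x \<longrightarrow> has_cont_extension f y z) \<and>
      (\<exists>\<epsilon>'>0. \<forall>y z. x \<le> y \<and> y < z \<and> z < x + \<epsilon>' \<longrightarrow> has_cont_extension f y z)"
    by (intro conjI exI[of _ e]) auto
qed

section \<open>Discontinuity at zero\<close>

text \<open>A rational \<open>p\<close> close to \<open>- b / a\<close>. The bound on \<open>p\<close> ensures that scaling a point by \<open>p\<close> does not
  enlarge the values of other additive functions at it.\<close>

lemma rational_combination_small:
  fixes a b e :: real
  assumes "\<bar>b\<bar> \<le> \<bar>a\<bar>" "e > 0"
  obtains p :: rat where "\<bar>of_rat p\<bar> \<le> (1 :: real)" "\<bar>of_rat p * a + b\<bar> < e"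
proof (cases "b = 0")
  case True
  with assms(2) that[of 0] show ?thesis by simp
next
  case False
  then have "a \<noteq> 0" using assms(1) by auto
  define c where "c = \<bar>b / a\<bar>"
  have c: "0 < c" "c \<le> 1"
    using False \<open>a \<noteq> 0\<close> assms(1) by (auto simp: c_def abs_divide divide_le_eq)
  \<comment> \<open>Approximating \<open>c\<close> from below keeps the coefficient in the unit interval.\<close>
  have "max 0 (c - e / \<bar>a\<bar>) < c"
    using c \<open>a \<noteq> 0\<close> assms(2) by simp
  then obtain r where r: "max 0 (c - e / \<bar>a\<bar>) < of_rat r" "of_rat r < c"
    using of_rat_dense by blast
  define s :: rat where "s = (if a * b > 0 then - 1 else 1)"
  have b: "b = - of_rat s * c * a"
    using False \<open>a \<noteq> 0\<close>
    by (auto simp: s_def c_def abs_if field_simps zero_less_mult_iff split: if_splits)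
  have s: "\<bar>of_rat s\<bar> = (1 :: real)"
    by (simp add: s_def)
  have "of_rat (s * r) * a + b = of_rat s * (of_rat r - c) * a"
    by (subst b) (simp add: of_rat_mult algebra_simps)
  then have "\<bar>of_rat (s * r) * a + b\<bar> = (c - of_rat r) * \<bar>a\<bar>"
    using r s by (simp add: abs_mult)
  also have "\<dots> < e / \<bar>a\<bar> * \<bar>a\<bar>"
    using r \<open>a \<noteq> 0\<close> by (intro mult_strict_right_mono) auto
  finally have "\<bar>of_rat (s * r) * a + b\<bar> < e"
    using \<open>a \<noteq> 0\<close> by simp
  moreover have "\<bar>of_rat (s * r)\<bar> \<le> (1 :: real)"
  proof -
    have "\<bar>of_rat r\<bar> \<le> (1 :: real)"
      using r c by linarith
    then show ?thesis
      using s by (simp only: of_rat_mult abs_mult mult_1)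
  qed
  ultimately show ?thesis
    using that by blast
qed

text \<open>
  Linear dependence in a finite-dimensional space, in an approximate form with rational coefficients
  and by induction on the number of additive functions. To accommodate a further function \<open>H\<close>, take
  two points with disjoint supports that are good for the other functions and combine them so that
  the two values of \<open>H\<close> almost cancel. The point with the smaller value keeps
  coefficient \<open>1\<close>, so its large coordinate survives. Disjoint supports are available because \<open>C\<close>
  ranges over all infinite subsets of the basis.
\<close>

lemma small_additive_large_coordinate:
  fixes F :: "(real \<Rightarrow> real) set" and e :: real
  assumes B: "hamel_basis B"
    and "finite F" "\<And>H. H \<in> F \<Longrightarrow> Modules.additive H"
    and "infinite C" "C \<subseteq> B" "e > 0"
  shows "\<exists>x. {b. coord B b x \<noteq> 0} \<subseteq> C \<and> (\<exists>b. \<bar>coord B b x\<bar> \<ge> 1) \<and> (\<forall>H\<in>F. \<bar>H x\<bar> < e)"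
  using assms(2-)
proof (induct F arbitrary: C e)
  case empty
  then obtain b where "b \<in> C" by fastforce
  with empty.prems show ?case
    by (intro exI[of _ b]) (auto simp: coord_basis[OF B] subset_iff split: if_splits)
next
  case (insert H F)
  have "e / 2 > 0" using insert.prems by simp
  have F: "\<And>G. G \<in> F \<Longrightarrow> Modules.additive G" and H: "Modules.additive H"
    using insert.prems by auto
  obtain u where u: "{b. coord B b u \<noteq> 0} \<subseteq> C" "\<exists>b. \<bar>coord B b u\<bar> \<ge> 1" "\<forall>G\<in>F. \<bar>G u\<bar> < e / 2"
    using insert.hyps(3)[OF F insert.prems(2,3) \<open>e / 2 > 0\<close>] by blast
  have inf: "infinite (C - {b. coord B b u \<noteq> 0})"
    using insert.prems(2) finite_coord_support by simp
  have sub: "C - {b. coord B b u \<noteq> 0} \<subseteq> B"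
    using insert.prems(3) by blast
  obtain v where v: "{b. coord B b v \<noteq> 0} \<subseteq> C - {b. coord B b u \<noteq> 0}" "\<exists>b. \<bar>coord B b v\<bar> \<ge> 1"
    "\<forall>G\<in>F. \<bar>G v\<bar> < e / 2"
    using insert.hyps(3)[OF F inf sub \<open>e / 2 > 0\<close>] by blast
  have disjoint: "coord B b u = 0 \<or> coord B b v = 0" for b
    using v(1) by blast
  have combine: ?case
    if "\<bar>H v\<bar> \<le> \<bar>H u\<bar>"
      and u: "{b. coord B b u \<noteq> 0} \<subseteq> C" "\<forall>G\<in>F. \<bar>G u\<bar> < e / 2"
      and v: "{b. coord B b v \<noteq> 0} \<subseteq> C" "\<exists>b. \<bar>coord B b v\<bar> \<ge> 1" "\<forall>G\<in>F. \<bar>G v\<bar> < e / 2"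
      and disjoint: "\<And>b. coord B b u = 0 \<or> coord B b v = 0"
    for u v
  proof -
    obtain p where p: "\<bar>of_rat p\<bar> \<le> (1 :: real)" "\<bar>of_rat p * H u + H v\<bar> < e"
      using rational_combination_small \<open>\<bar>H v\<bar> \<le> \<bar>H u\<bar>\<close> \<open>e > 0\<close> by blast
    define x where "x = of_rat p * u + v"
    have coord: "coord B b x = of_rat p * coord B b u + coord B b v" for b
      using coord_combination[OF B, of b p u 1 v] by (simp add: x_def)
    have val: "G x = of_rat p * G u + G v" if "Modules.additive G" for G :: "real \<Rightarrow> real"
      by (simp add: x_def additive.add[OF that] additive_of_rat_mult[OF that])
    have "\<bar>G x\<bar> < e" if "G \<in> F" for G
    proof -
      have "\<bar>of_rat p * G u\<bar> \<le> \<bar>G u\<bar>"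
        using mult_right_mono[OF p(1), of "\<bar>G u\<bar>"] by (simp add: abs_mult)
      moreover have "\<bar>G u\<bar> < e / 2" "\<bar>G v\<bar> < e / 2"
        using that u v by auto
      ultimately show ?thesis
        unfolding val[OF F[OF that]] by linarith
    qed
    moreover have "\<bar>H x\<bar> < e"
      using p(2) val[OF H] by simp
    moreover have "{b. coord B b x \<noteq> 0} \<subseteq> C"
      using u(1) v(1) by (force simp: coord)
    moreover obtain b where "\<bar>coord B b v\<bar> \<ge> 1"
      using v(2) by blast
    then have "\<bar>coord B b x\<bar> \<ge> 1"
      using disjoint[of b] by (auto simp: coord)
    ultimately show ?thesis by blast
  qed
  show ?case
  proof (cases "\<bar>H v\<bar> \<le> \<bar>H u\<bar>")
    case True
    then show ?thesis
      by (rule combine) (use u v disjoint in auto)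
  next
    case False
    then have "\<bar>H u\<bar> \<le> \<bar>H v\<bar>" by simp
    then show ?thesis
      by (rule combine) (use u v disjoint in auto)
  qed
qed

lemma coord_norm_not_topcontinuous_at_zero:
  assumes B: "hamel_basis B"
  shows "\<not> topcontinuous_at tau_H euclidean (coord_norm B) 0"
proof
  assume "topcontinuous_at tau_H euclidean (coord_norm B) 0"
  moreover have "openin euclidean {..<1 :: real}" "coord_norm B 0 \<in> {..<1}"
    by (auto simp: coord_norm_zero)
  ultimately have "\<exists>U. openin tau_H U \<and> 0 \<in> U \<and> (\<forall>x\<in>U. coord_norm B x \<in> {..<1})"
    unfolding topcontinuous_at_def by metis
  then obtain U where U: "openin tau_H U" "0 \<in> U" "\<forall>x\<in>U. coord_norm B x < 1"
    by auto
  obtain F :: "(real \<Rightarrow> real) set" and e where F: "finite F" "\<forall>H\<in>F. Modules.additive H" "e > 0"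
    and FU: "{x. \<forall>H\<in>F. \<bar>H x\<bar> < e} \<subseteq> U"
    using tau_H_nhds_zero[OF U(1,2)] by blast
  obtain x b where "\<bar>coord B b x\<bar> \<ge> 1" "\<forall>H\<in>F. \<bar>H x\<bar> < e"
    using small_additive_large_coordinate[OF B F(1) _ infinite_hamel_basis[OF B] subset_refl F(3)] F(2)
    by blast
  then show False
    using abs_coord_le_coord_norm[of B b x] FU U(3) by fastforce
qed

theorem theorem9p8:
  assumes "\<exists>B. hamel_basis B"
  shows "(\<exists>f :: real \<Rightarrow> real. bilaterally_Q_continuous f \<and> \<not> topcontinuous_at tau_H euclidean f 0) \<and>
    \<not> (\<forall>f :: real \<Rightarrow> real. bilaterally_Q_continuous f \<longrightarrow> continuous_map tau_H euclidean f) \<and>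
    \<not> (\<forall>f :: real \<Rightarrow> real. Q_continuous f \<longrightarrow> continuous_map tau_H euclidean f)"
proof -
  obtain B where B: "hamel_basis B"
    using assms by blast
  have "\<not> continuous_map tau_H euclidean (coord_norm B)"
    using coord_norm_not_topcontinuous_at_zero[OF B]
    by (auto simp: continuous_map_eq_topcontinuous_at)
  then show ?thesis
    using bilaterally_Q_continuous_coord_norm[OF B] coord_norm_not_topcontinuous_at_zero[OF B]
      bilaterally_Q_continuous_imp_Q_continuous by blast
qed

end
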